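(* Every retract of a strong $R$-space is a strong $R$-space. That is, if $X$ is a strong $R$-space, $Y$ is a topological space, and there are continuous mappings $f:X\to Y$ and $g:Y\to X$ with $f\circ g=\mathrm{id}_Y$, then $Y$ is a strong $R$-space.
   Context: For a $T_0$-space $X$: a subset is saturated if it equals the intersection of all open sets containing it; $Q(X)$ is the set of all nonempty compact saturated subsets of $X$ (compactness is the open-cover property). A $T_0$-space $X$ is a strong $R$-space if for every nonempty family $\{K_i: i\in I\}\subseteq Q(X)$ and every open $U\subseteq X$, $\bigcap_{i\in I}K_i\subseteq U$ implies $\bigcap_{i\in J}K_i\subseteq U$ for some nonempty finite $J\subseteq I$. (In particular, being a strong $R$-space includes being $T_0$.) *)

theory Defs
  imports "HOL-Analysis.Analysis"
begin

(* The explicit inclusion keeps the intersection from being that of an empty family: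
   it guarantees that "topspace X" itself is one of the open sets containing "A". *)
definition saturatedin :: "'a topology \<Rightarrow> 'a set \<Rightarrow> bool" where
  "saturatedin X A \<longleftrightarrow>
     A \<subseteq> topspace X \<and> A = \<Inter>{U. openin X U \<and> A \<subseteq> U}"

definition compact_saturated_sets :: "'a topology \<Rightarrow> 'a set set" where
  "compact_saturated_sets X = {K. K \<noteq> {} \<and> compactin X K \<and> saturatedin X K}"

(* A family of sets is represented by the set of its members.  Repetitions do not affect
   intersections, and finite subfamilies of an indexed family have exactly the finite
   subsets of its range as their sets of members, so nothing is lost; this avoids
   quantifying over index types. *)
definition strong_R_space :: "'a topology \<Rightarrow> bool" where
  "strong_R_space X \<longleftrightarrow>
     t0_space X \<and>
     (\<forall>\<K> U. \<K> \<noteq> {} \<and> \<K> \<subseteq> compact_saturated_sets X \<and> openin X U \<and> \<Inter>\<K> \<subseteq> U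
        \<longrightarrow> (\<exists>\<F>. \<F> \<noteq> {} \<and> finite \<F> \<and> \<F> \<subseteq> \<K> \<and> \<Inter>\<F> \<subseteq> U))"

end

(* Send a compact saturated K in Y to the saturation of g ` K in X.  As f is continuous with
   f (g y) = y, it maps this saturation back into K; so an inclusion of an intersection in an
   open U transfers to X with the open preimage of U under f, and g carries the finite
   subfamily found there back to Y. *)
theory Submission
  imports Defs
begin

text \<open>If \<open>A\<close> is not contained in \<open>topspace X\<close>, no open set contains
  it and the intersection is \<open>UNIV\<close>; hence the assumption
  \<open>A \<subseteq> topspace X\<close> in several lemmas below.\<close>

definition saturation_of :: "'a topology \<Rightarrow> 'a set \<Rightarrow> 'a set" where
  "saturation_of X A = \<Inter>{U. openin X U \<and> A \<subseteq> U}"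

lemma saturation_of_superset: "A \<subseteq> saturation_of X A"
  by (auto simp: saturation_of_def)

lemma saturation_of_minimal: "openin X U \<Longrightarrow> A \<subseteq> U \<Longrightarrow> saturation_of X A \<subseteq> U"
  by (auto simp: saturation_of_def)

lemma saturation_of_subset_topspace:
  "A \<subseteq> topspace X \<Longrightarrow> saturation_of X A \<subseteq> topspace X"
  by (simp add: saturation_of_minimal)

lemma saturatedin_iff: "saturatedin X A \<longleftrightarrow> A \<subseteq> topspace X \<and> saturation_of X A = A"
  by (auto simp: saturatedin_def saturation_of_def)

lemma saturatedin_saturation_of:
  assumes "A \<subseteq> topspace X"
  shows "saturatedin X (saturation_of X A)"
proof -
  have "saturation_of X (saturation_of X A) \<subseteq> saturation_of X A"
    unfolding saturation_of_def by blast
  then show ?thesis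
    using saturation_of_subset_topspace[OF assms]
    by (simp add: saturatedin_iff saturation_of_superset subset_antisym)
qed

text \<open>A union of open sets that contains \<open>A\<close> is itself open, hence contains the
  saturation too; so a finite subcover found for \<open>A\<close> already covers the
  saturation.\<close>

lemma compactin_saturation_of:
  assumes "compactin X A"
  shows "compactin X (saturation_of X A)"
  unfolding compactin_def
proof (intro conjI allI impI)
  show "saturation_of X A \<subseteq> topspace X"
    using saturation_of_subset_topspace[OF compactin_subset_topspace[OF assms]] .
next
  fix \<U>
  assume \<U>: "Ball \<U> (openin X) \<and> saturation_of X A \<subseteq> \<Union>\<U>"
  then have "A \<subseteq> \<Union>\<U>"
    using saturation_of_superset[of A X] by blast
  then obtain \<F> where \<F>: "finite \<F>" "\<F> \<subseteq> \<U>" "A \<subseteq> \<Union>\<F>"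
    using \<U> compactinD[OF assms, of \<U>] by blast
  then have "saturation_of X A \<subseteq> \<Union>\<F>"
    using \<U> by (intro saturation_of_minimal openin_Union) auto
  with \<F> show "\<exists>\<F>. finite \<F> \<and> \<F> \<subseteq> \<U> \<and> saturation_of X A \<subseteq> \<Union>\<F>"
    by blast
qed

lemma saturation_of_in_compact_saturated_sets:
  assumes "compactin X A" "A \<noteq> {}"
  shows "saturation_of X A \<in> compact_saturated_sets X"
  using assms compactin_saturation_of[OF assms(1)] saturation_of_superset[of A X]
    saturatedin_saturation_of[OF compactin_subset_topspace[OF assms(1)]]
  by (auto simp: compact_saturated_sets_def)

lemma continuous_map_image_saturation_of_subset:
  assumes f: "continuous_map X Y f" and A: "A \<subseteq> topspace X"
  shows "f ` saturation_of X A \<subseteq> saturation_of Y (f ` A)"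
proof -
  have "saturation_of X A \<subseteq> {x \<in> topspace X. f x \<in> V}"
    if "openin Y V" "f ` A \<subseteq> V" for V
    using that A by (intro saturation_of_minimal openin_continuous_map_preimage[OF f]) auto
  then show ?thesis
    unfolding saturation_of_def[of Y] by blast
qed

text \<open>Injectivity keeps \<open>g y\<close> and \<open>g z\<close> distinct, and the preimage
  of an open set separating them separates \<open>y\<close> and \<open>z\<close>. It applies to a
  section \<open>g\<close>, which is injective because it has a left inverse.\<close>

lemma t0_space_injective_continuous_map:
  assumes "t0_space X" and g: "continuous_map Y X g" and "inj_on g (topspace Y)"
  shows "t0_space Y"
  unfolding t0_space_def
proof (intro ballI impI)
  fix y z
  assume yz: "y \<in> topspace Y" "z \<in> topspace Y" "y \<noteq> z"
  then have "g y \<in> topspace X" "g z \<in> topspace X" "g y \<noteq> g z"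
    using assms by (auto simp: continuous_map_def inj_on_def)
  then obtain V where V: "openin X V" "g y \<notin> V \<longleftrightarrow> g z \<in> V"
    using assms(1) unfolding t0_space_def by blast
  have "openin Y {w \<in> topspace Y. g w \<in> V}"
    using openin_continuous_map_preimage[OF g V(1)] .
  with V yz show "\<exists>U. openin Y U \<and> (y \<notin> U \<longleftrightarrow> z \<in> U)"
    by (intro exI[of _ "{w \<in> topspace Y. g w \<in> V}"]) auto
qed

theorem proposition5p3:
  fixes X :: "'a topology" and Y :: "'b topology"
    and f :: "'a \<Rightarrow> 'b" and g :: "'b \<Rightarrow> 'a"
  assumes "strong_R_space X"
    and "continuous_map X Y f" and "continuous_map Y X g"
    and "\<forall>y \<in> topspace Y. f (g y) = y"
  shows "strong_R_space Y"
  unfolding strong_R_space_def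
proof (intro conjI allI impI)
  have "inj_on g (topspace Y)"
    using assms(4) by (auto intro: inj_on_inverseI)
  then show "t0_space Y"
    using assms(1,3) by (auto simp: strong_R_space_def intro: t0_space_injective_continuous_map)
next
  fix \<K> U
  assume "\<K> \<noteq> {} \<and> \<K> \<subseteq> compact_saturated_sets Y \<and> openin Y U \<and> \<Inter>\<K> \<subseteq> U"
  then have ne: "\<K> \<noteq> {}" and \<K>: "\<K> \<subseteq> compact_saturated_sets Y"
    and U: "openin Y U" and sub: "\<Inter>\<K> \<subseteq> U"
    by auto
  define S where "S K = saturation_of X (g ` K)" for K
  define W where "W = {x \<in> topspace X. f x \<in> U}"
  have K: "K \<noteq> {}" "compactin Y K" "K \<subseteq> topspace Y" "saturation_of Y K = K" if "K \<in> \<K>" for K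
    using that \<K> by (auto simp: compact_saturated_sets_def saturatedin_iff)
  have gK: "compactin X (g ` K)" if "K \<in> \<K>" for K
    using image_compactin[OF K(2)[OF that] assms(3)] .
  have S: "S K \<in> compact_saturated_sets X" if "K \<in> \<K>" for K
    unfolding S_def using gK K(1) that by (intro saturation_of_in_compact_saturated_sets) auto
  \<comment> \<open>Saturatedness of \<open>K\<close> enters here: continuity only puts the image
    into the saturation of \<open>f\<close> g \<open>K\<close>, which is the saturation of
    \<open>K\<close>.\<close>
  have fS: "f ` S K \<subseteq> K" if "K \<in> \<K>" for K
  proof -
    have "f ` g ` K = K"
      using K(3)[OF that] assms(4) by (force simp: image_image)
    then show ?thesis
      using continuous_map_image_saturation_of_subset[OF assms(2)
          compactin_subset_topspace[OF gK[OF that]]] K(4)[OF that]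
      by (simp add: S_def)
  qed
  have "openin X W"
    unfolding W_def using openin_continuous_map_preimage[OF assms(2) U] .
  moreover have "\<Inter>(S ` \<K>) \<subseteq> W"
  proof
    fix x
    assume x: "x \<in> \<Inter>(S ` \<K>)"
    \<comment> \<open>An empty intersection would be \<open>UNIV\<close>, so a member of the
      nonempty family \<open>\<K>\<close> is needed to place \<open>x\<close> in the space.\<close>
    have "x \<in> topspace X"
    proof -
      obtain K where "K \<in> \<K>"
        using ne by blast
      then have "x \<in> S K" "S K \<subseteq> topspace X"
        using x S[of K] by (auto simp: compact_saturated_sets_def dest: compactin_subset_topspace)
      then show ?thesis
        by blast
    qed
    moreover have "f x \<in> U"
    proof -
      have "f x \<in> K" if "K \<in> \<K>" for K
        using x fS[OF that] that by blast
      then show ?thesis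
        using sub by blast
    qed
    ultimately show "x \<in> W"
      by (simp add: W_def)
  qed
  moreover have "S ` \<K> \<noteq> {}" "S ` \<K> \<subseteq> compact_saturated_sets X"
    using ne S by auto
  ultimately have "\<exists>\<G>. \<G> \<noteq> {} \<and> finite \<G> \<and> \<G> \<subseteq> S ` \<K> \<and> \<Inter>\<G> \<subseteq> W"
    using assms(1)[unfolded strong_R_space_def, THEN conjunct2, rule_format, of "S ` \<K>" W] by simp
  then obtain \<G> where \<G>: "\<G> \<noteq> {}" "finite \<G>" "\<G> \<subseteq> S ` \<K>" "\<Inter>\<G> \<subseteq> W"
    by blast
  \<comment> \<open>The finite subfamily consists of saturations in \<open>X\<close>; choosing one
    \<open>K\<close> in \<open>\<K>\<close> for each of them gives a finite subfamily in
    \<open>Y\<close>.\<close>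
  obtain \<F> where \<F>: "\<F> \<subseteq> \<K>" "finite \<F>" "\<G> = S ` \<F>"
    using finite_subset_image[OF \<G>(2,3)] by blast
  have "\<F> \<noteq> {}"
    using \<G>(1) \<F>(3) by simp
  have "\<Inter>\<F> \<subseteq> U"
  proof
    fix y
    assume y: "y \<in> \<Inter>\<F>"
    then have "g y \<in> S K" if "K \<in> \<F>" for K
      using that saturation_of_superset[of "g ` K" X] unfolding S_def by blast
    then have "g y \<in> \<Inter>\<G>"
      by (simp add: \<F>(3))
    then have "f (g y) \<in> U"
      using \<G>(4) by (auto simp: W_def)
    \<comment> \<open>The identity \<open>f (g y) = y\<close> is assumed only on
      \<open>topspace Y\<close>; a member of the nonempty \<open>\<F>\<close> shows that
      \<open>y\<close> lies there.\<close>
    moreover have "y \<in> topspace Y"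
      using y K(3) \<F>(1) \<open>\<F> \<noteq> {}\<close> by blast
    ultimately show "y \<in> U"
      using assms(4) by simp
  qed
  with \<F>(1,2) \<open>\<F> \<noteq> {}\<close> show "\<exists>\<F>. \<F> \<noteq> {} \<and> finite \<F> \<and> \<F> \<subseteq> \<K> \<and> \<Inter>\<F> \<subseteq> U"
    by blast
qed

end
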